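(* 1. For all $k\ge1$ put $p_k=\dim(V_k)$, and $F_V=\sum_{k=1}^\infty p_kX^k$. Then $$F_V=\frac{X}{1-X-X^2},$$ and for all $k\ge1$, $$p_k=\frac{1}{\sqrt5}\left(\left(\frac{1+\sqrt5}{2}\right)^k-\left(\frac{1-\sqrt5}{2}\right)^k\right),$$ that is, $(p_k)_{k\geq 1}$ is the Fibonacci sequence. 2. Put $F_H=\sum_{k=0}^\infty\dim(H_k)X^k$. Then $$F_H=\prod_{k=1}^\infty\frac{1}{(1-X^k)^{p_k}}.$$
   Context: $\mathbb{K}$ is a field of characteristic zero. $V$ is the vector space with basis $(X_c)$ indexed by all words $c$ (including the empty word) in two letters $x_0,x_1$, and $H=S(V)$ is the symmetric algebra of $V$. The degree of a word $c=c_1\ldots c_n$ is $\deg(c)=n+1+\sharp\{i\in\{1,\ldots,n\}\mid c_i=x_0\}$. For $k\ge1$, $V_k=\mathrm{Vect}(X_c\mid\deg(c)=k)$; the gradation $V=\bigoplus_{k\ge1}V_k$ induces an algebra gradation $H=\bigoplus_{k\ge0}H_k$ with $H_0=\mathbb{K}$. *)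

theory Defs
  imports
    "HOL-Analysis.Analysis"
    "HOL-Library.Poly_Mapping"
    "HOL-Computational_Algebra.Computational_Algebra"
    "HOL-Number_Theory.Fib"
begin

datatype letter = x0 | x1

type_synonym word = "letter list"

definition word_deg :: "word \<Rightarrow> nat" where
  "word_deg c = length c + 1 + card {i. i < length c \<and> c ! i = x0}"

text \<open>The free vector space on \<open>'b\<close> over a field \<open>'k\<close> is the type of finitely supported functions
  \<open>'b \<Rightarrow>\<^sub>0 'k\<close>; \<open>single b 1\<close> is the basis vector indexed by \<open>b\<close>.\<close>

definition pm_scale :: "'k::field \<Rightarrow> ('b \<Rightarrow>\<^sub>0 'k) \<Rightarrow> ('b \<Rightarrow>\<^sub>0 'k)" where
  "pm_scale a = Poly_Mapping.map ((*) a)"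

lemma lookup_pm_scale [simp]:
  "Poly_Mapping.lookup (pm_scale a v) b = a * Poly_Mapping.lookup v b"
  by (simp add: pm_scale_def Poly_Mapping.map.rep_eq when_def)

interpretation pm: vector_space "pm_scale :: 'k::field \<Rightarrow> ('b \<Rightarrow>\<^sub>0 'k) \<Rightarrow> ('b \<Rightarrow>\<^sub>0 'k)"
  by unfold_locales (auto intro!: poly_mapping_eqI simp: lookup_add algebra_simps)

type_synonym 'k V = "word \<Rightarrow>\<^sub>0 'k"

text \<open>Since \<open>V\<close> has basis \<open>(X\<^sub>c)\<close>, its symmetric algebra is the algebra of polynomials in the
  commuting indeterminates \<open>X\<^sub>c\<close>: finitely supported functions on the monomials \<open>word \<Rightarrow>\<^sub>0 nat\<close>.
  Its universal property is proved below.\<close>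

type_synonym 'k H = "(word \<Rightarrow>\<^sub>0 nat) \<Rightarrow>\<^sub>0 'k"

definition X :: "word \<Rightarrow> 'k::field V" where
  "X c = Poly_Mapping.single c 1"

text \<open>The canonical linear injection of \<open>V\<close> into its symmetric algebra.\<close>

definition incl :: "'k::field V \<Rightarrow> 'k H" where
  "incl v = (\<Sum>c\<in>Poly_Mapping.keys v. pm_scale (Poly_Mapping.lookup v c)
     (Poly_Mapping.single (Poly_Mapping.single c 1) 1))"

definition V_part :: "nat \<Rightarrow> 'k::field V set" where
  "V_part k = pm.span {X c | c. word_deg c = k}"

text \<open>The grading of the symmetric algebra induced by \<open>V_part\<close>: degree \<open>k\<close> is spanned by the
  products of homogeneous vectors whose degrees add up to \<open>k\<close>. The empty product
  gives the scalars in degree \<open>0\<close>.\<close>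

definition H_part :: "nat \<Rightarrow> 'k::field H set" where
  "H_part k = pm.span {(\<Prod>i<m. incl (v i)) | (m::nat) v d.
     (\<forall>i<m. 1 \<le> d i \<and> v i \<in> V_part (d i)) \<and> (\<Sum>i<m. d i) = k}"

lemma pm_scale_single: "pm_scale a (Poly_Mapping.single b c) = Poly_Mapping.single b (a * c)"
  by (rule poly_mapping_eqI) (simp add: lookup_single when_def)

lemma pm_expand:
  "finite A \<Longrightarrow> Poly_Mapping.keys v \<subseteq> A \<Longrightarrow> v = (\<Sum>b\<in>A. Poly_Mapping.single b (Poly_Mapping.lookup v b))"
  by (rule poly_mapping_eqI)
    (auto simp: lookup_sum lookup_single when_def in_keys_iff sum.delta)

lemma incl_expand:
  assumes "finite A" "Poly_Mapping.keys v \<subseteq> A"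
  shows "incl v = (\<Sum>c\<in>A. pm_scale (Poly_Mapping.lookup v c)
    (Poly_Mapping.single (Poly_Mapping.single c 1) 1))"
  unfolding incl_def using assms
  by (intro sum.mono_neutral_left) (auto simp: in_keys_iff)

lemma incl_add: "incl (u + v) = incl u + incl v"
proof -
  let ?A = "Poly_Mapping.keys u \<union> Poly_Mapping.keys v"
  have "Poly_Mapping.keys (u + v) \<subseteq> ?A" by (rule keys_add)
  then show ?thesis
    by (simp add: incl_expand[of ?A] lookup_add pm.scale_left_distrib sum.distrib)
qed

lemma incl_scale: "incl (pm_scale a v) = pm_scale a (incl v)"
proof -
  have "Poly_Mapping.keys (pm_scale a v) \<subseteq> Poly_Mapping.keys v" by (auto simp: in_keys_iff)
  then show ?thesis
    by (simp add: incl_expand[of "Poly_Mapping.keys v"] pm.scale_sum_right)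
qed

lemma incl_X: "incl (X c) = Poly_Mapping.single (Poly_Mapping.single c 1) 1"
  by (simp add: X_def incl_def)

text \<open>A commutative \<open>'k\<close>-algebra is given by a ring homomorphism \<open>\<phi>\<close> from \<open>'k\<close> to a
  commutative ring.\<close>

theorem incl_universal:
  fixes \<phi> :: "'k::field \<Rightarrow> 'a::comm_ring_1" and f :: "'k V \<Rightarrow> 'a"
  assumes \<phi>: "\<And>a b. \<phi> (a + b) = \<phi> a + \<phi> b" "\<And>a b. \<phi> (a * b) = \<phi> a * \<phi> b" "\<phi> 1 = 1"
    and f: "\<And>u v. f (u + v) = f u + f v" "\<And>a v. f (pm_scale a v) = \<phi> a * f v"
  shows "\<exists>!g :: 'k H \<Rightarrow> 'a.
    (\<forall>p q. g (p + q) = g p + g q) \<and> (\<forall>p q. g (p * q) = g p * g q) \<and> g 1 = 1 \<and>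
    (\<forall>a p. g (pm_scale a p) = \<phi> a * g p) \<and> (\<forall>v. g (incl v) = f v)"
proof -
  have \<phi>0: "\<phi> 0 = 0" using \<phi>(1)[of 0 0] by simp
  define M where "M m = (\<Prod>c\<in>Poly_Mapping.keys m. f (X c) ^ Poly_Mapping.lookup m c)"
    for m :: "word \<Rightarrow>\<^sub>0 nat"
  have M_expand: "M m = (\<Prod>c\<in>A. f (X c) ^ Poly_Mapping.lookup m c)"
    if "finite A" "Poly_Mapping.keys m \<subseteq> A" for m A
    unfolding M_def using that by (intro prod.mono_neutral_left) (auto simp: in_keys_iff)
  have M_add: "M (m + n) = M m * M n" for m n
  proof -
    let ?A = "Poly_Mapping.keys m \<union> Poly_Mapping.keys n"
    have "Poly_Mapping.keys (m + n) \<subseteq> ?A" by (rule keys_add)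
    then show ?thesis
      by (simp add: M_expand[of ?A] lookup_add power_add prod.distrib)
  qed
  define g where "g p = (\<Sum>m\<in>Poly_Mapping.keys p. \<phi> (Poly_Mapping.lookup p m) * M m)"
    for p :: "'k H"
  have g_expand: "g p = (\<Sum>m\<in>A. \<phi> (Poly_Mapping.lookup p m) * M m)"
    if "finite A" "Poly_Mapping.keys p \<subseteq> A" for p A
    unfolding g_def using that by (intro sum.mono_neutral_left) (auto simp: in_keys_iff \<phi>0)
  have g_add: "g (p + q) = g p + g q" for p q
  proof -
    let ?A = "Poly_Mapping.keys p \<union> Poly_Mapping.keys q"
    have "Poly_Mapping.keys (p + q) \<subseteq> ?A" by (rule keys_add)
    then show ?thesis
      by (simp add: g_expand[of ?A] lookup_add \<phi> distrib_right sum.distrib)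
  qed
  have g_0: "g 0 = 0" by (simp add: g_def)
  have g_sum: "g (\<Sum>i\<in>A. P i) = (\<Sum>i\<in>A. g (P i))" if "finite A"
    for A :: "(word \<Rightarrow>\<^sub>0 nat) set" and P
    using that by (induction A) (auto simp: g_0 g_add)
  have g_sum': "g (\<Sum>i\<in>A. P i) = (\<Sum>i\<in>A. g (P i))" if "finite A"
    for A :: "word set" and P
    using that by (induction A) (auto simp: g_0 g_add)
  have g_single: "g (Poly_Mapping.single m a) = \<phi> a * M m" for m a
    by (simp add: g_def \<phi>0)
  have g_scale: "g (pm_scale a p) = \<phi> a * g p" for a p
  proof -
    have "Poly_Mapping.keys (pm_scale a p) \<subseteq> Poly_Mapping.keys p" by (auto simp: in_keys_iff)
    then show ?thesis
      by (simp add: g_expand[of "Poly_Mapping.keys p"] \<phi> sum_distrib_left mult.assoc)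
  qed
  have g_mult: "g (p * q) = g p * g q" for p q
  proof -
    let ?P = "Poly_Mapping.keys p" and ?Q = "Poly_Mapping.keys q"
    have "p * q = (\<Sum>m\<in>?P. Poly_Mapping.single m (Poly_Mapping.lookup p m)) *
        (\<Sum>n\<in>?Q. Poly_Mapping.single n (Poly_Mapping.lookup q n))"
      using pm_expand[of ?P p] pm_expand[of ?Q q] by simp
    also have "\<dots> = (\<Sum>m\<in>?P. \<Sum>n\<in>?Q. Poly_Mapping.single (m + n)
        (Poly_Mapping.lookup p m * Poly_Mapping.lookup q n))"
      by (simp add: sum_product mult_single)
    finally have "g (p * q) = (\<Sum>m\<in>?P. \<Sum>n\<in>?Q. \<phi> (Poly_Mapping.lookup p m) *
        \<phi> (Poly_Mapping.lookup q n) * (M m * M n))"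
      by (simp add: g_sum g_single \<phi> M_add)
    also have "\<dots> = g p * g q"
      by (simp add: g_def sum_product mult_ac)
    finally show ?thesis .
  qed
  have g_one: "g 1 = 1"
    using g_single[of 0 1] by (simp add: \<phi> M_def)
  have M_X: "M (Poly_Mapping.single c 1) = f (X c)" for c
    by (simp add: M_def)
  have f_0: "f 0 = 0" using f(1)[of 0 0] by simp
  have f_sum: "f (\<Sum>i\<in>A. P i) = (\<Sum>i\<in>A. f (P i))" if "finite A" for A :: "word set" and P
    using that by (induction A) (auto simp: f_0 f)
  have g_incl: "g (incl v) = f v" for v
  proof -
    have "g (incl v) = (\<Sum>c\<in>Poly_Mapping.keys v. \<phi> (Poly_Mapping.lookup v c) * f (X c))"
      using M_X by (simp add: incl_def g_sum' g_scale g_single \<phi>)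
    also have "\<dots> = f (\<Sum>c\<in>Poly_Mapping.keys v. pm_scale (Poly_Mapping.lookup v c) (X c))"
      by (simp add: f_sum f)
    also have "(\<Sum>c\<in>Poly_Mapping.keys v. pm_scale (Poly_Mapping.lookup v c) (X c)) = v"
      using pm_expand[of "Poly_Mapping.keys v" v] by (simp add: X_def pm_scale_single)
    finally show ?thesis .
  qed
  show ?thesis
  proof (rule ex1I[of _ g], goal_cases)
    case 1
    show ?case using g_add g_mult g_one g_scale g_incl by blast
  next
    case (2 h)
    then have h: "\<And>p q. h (p + q) = h p + h q" "\<And>p q. h (p * q) = h p * h q" "h 1 = 1"
      "\<And>a p. h (pm_scale a p) = \<phi> a * h p" "\<And>v. h (incl v) = f v" by auto
    have h_0: "h 0 = 0" using h(1)[of 0 0] by simp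
    have h_sum: "h (\<Sum>i\<in>A. P i) = (\<Sum>i\<in>A. h (P i))" if "finite A"
      for A :: "(word \<Rightarrow>\<^sub>0 nat) set" and P
      using that by (induction A) (auto simp: h_0 h)
    have hX: "h (Poly_Mapping.single (Poly_Mapping.single c 1) 1) = f (X c)" for c
      using h(5)[of "X c"] by (simp add: incl_X)
    have hpow: "h (Poly_Mapping.single (Poly_Mapping.single c n) 1) = f (X c) ^ n" for c n
    proof (induction n)
      case 0
      show ?case using h(3) by simp
    next
      case (Suc n)
      have "Poly_Mapping.single (Poly_Mapping.single c (Suc n)) (1::'k) =
        Poly_Mapping.single (Poly_Mapping.single c 1) 1 *
        Poly_Mapping.single (Poly_Mapping.single c n) 1"
        by (simp add: mult_single flip: single_add)
      then show ?case using Suc hX by (simp add: h(2))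
    qed
    have hprod: "h (Poly_Mapping.single (\<Sum>c\<in>A. Poly_Mapping.single c (e c)) 1) =
        (\<Prod>c\<in>A. f (X c) ^ e c)" if "finite A" for A :: "word set" and e :: "word \<Rightarrow> nat"
      using that
    proof (induction A)
      case empty
      show ?case using h(3) by simp
    next
      case (insert c A)
      have "Poly_Mapping.single (\<Sum>c\<in>insert c A. Poly_Mapping.single c (e c)) (1::'k) =
        Poly_Mapping.single (Poly_Mapping.single c (e c)) 1 *
        Poly_Mapping.single (\<Sum>c\<in>A. Poly_Mapping.single c (e c)) 1"
        using insert by (simp add: mult_single)
      then show ?case using insert by (simp add: h(2) hpow)
    qed
    have hM: "h (Poly_Mapping.single m 1) = M m" for m
      using hprod[of "Poly_Mapping.keys m" "Poly_Mapping.lookup m"]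
        pm_expand[of "Poly_Mapping.keys m" m]
      by (simp add: M_def)
    have hsingle: "h (Poly_Mapping.single m a) = \<phi> a * M m" for m a
      using h(4)[of a "Poly_Mapping.single m 1"] by (simp add: hM pm_scale_single)
    show ?case
    proof
      fix p
      have "h p = h (\<Sum>m\<in>Poly_Mapping.keys p. Poly_Mapping.single m (Poly_Mapping.lookup p m))"
        using pm_expand[of "Poly_Mapping.keys p" p] by simp
      also have "\<dots> = g p" by (simp add: h_sum hsingle g_def)
      finally show "h p = g p" .
    qed
  qed
qed

end

theory Submission
  imports Defs
begin

text \<open>A word of degree \<open>k + 2\<close> is \<open>x\<^sub>0\<close> followed by a word of degree \<open>k\<close> or \<open>x\<^sub>1\<close> followed by one
  of degree \<open>k + 1\<close>, which is the Fibonacci recursion. \<open>H\<^sub>k\<close> has the monomials of weight \<open>k\<close> as a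
  basis. If \<open>F\<^sub>A\<close> is the generating function of the monomials in the indeterminates \<open>A\<close>, splitting
  off one factor \<open>b\<close> shows that \<open>F\<^bsub>A \<union> {b}\<^esub> (1 - X\<^sup>d) = F\<^sub>A\<close> with \<open>d = deg b\<close>, so \<open>F\<^sub>A\<close> is a product of
  geometric series when \<open>A\<close> is finite. The indeterminates of degree at most \<open>n\<close> already determine
  the coefficients of \<open>F\<^sub>H\<close> up to \<open>X\<^sup>n\<close>.\<close>

section \<open>Spans of basis vectors\<close>

text \<open>Kept generic in the index type so that the same facts serve \<open>V\<close>, indexed by
  words, and \<open>H\<close>, indexed by monomials.\<close>

definition basis_vec :: "'b \<Rightarrow> 'b \<Rightarrow>\<^sub>0 'k::field" where
  "basis_vec b = Poly_Mapping.single b 1"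

lemma inj_basis_vec: "inj (basis_vec :: 'b \<Rightarrow> 'b \<Rightarrow>\<^sub>0 'k::field)"
proof (rule injI)
  fix a b :: 'b assume "basis_vec a = (basis_vec b :: 'b \<Rightarrow>\<^sub>0 'k)"
  then have "Poly_Mapping.lookup (basis_vec a) a = Poly_Mapping.lookup (basis_vec b :: 'b \<Rightarrow>\<^sub>0 'k) a"
    by simp
  then show "a = b" by (simp add: basis_vec_def lookup_single when_def split: if_splits)
qed

lemma lookup_sum_basis_vec:
  "finite A \<Longrightarrow> Poly_Mapping.lookup (\<Sum>a\<in>A. pm_scale (u a) (basis_vec a)) b = (if b \<in> A then u b else 0)"
  by (simp add: lookup_sum basis_vec_def lookup_single when_def if_distrib cong: if_cong)

text \<open>Taking the coefficient at \<open>b\<close> of a vanishing combination isolates the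
  scalar attached to \<open>basis_vec b\<close>.\<close>

lemma independent_basis_vec: "pm.independent (basis_vec ` S :: ('b \<Rightarrow>\<^sub>0 'k::field) set)"
  unfolding pm.independent_explicit_module
proof (intro allI impI)
  fix t :: "('b \<Rightarrow>\<^sub>0 'k) set" and u v
  assume t: "finite t" "t \<subseteq> basis_vec ` S" "(\<Sum>v\<in>t. pm_scale (u v) v) = 0" "v \<in> t"
  obtain A where A: "t = basis_vec ` A" using t(2) by (auto simp: subset_image_iff)
  have inj: "inj_on (basis_vec :: 'b \<Rightarrow> 'b \<Rightarrow>\<^sub>0 'k) A" using inj_basis_vec by (rule inj_on_subset) auto
  have "finite A" using t(1) inj by (auto simp: A dest: finite_imageD)
  obtain b where b: "b \<in> A" "v = basis_vec b" using t(4) A by auto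
  have "(\<Sum>a\<in>A. pm_scale (u (basis_vec a)) (basis_vec a)) = 0"
    using t(3) by (simp add: A sum.reindex[OF inj])
  then show "u v = 0"
    using lookup_sum_basis_vec[OF \<open>finite A\<close>, of "\<lambda>a. u (basis_vec a)" b] b by simp
qed

lemma dim_span_basis_vec: "pm.dim (pm.span (basis_vec ` S :: ('b \<Rightarrow>\<^sub>0 'k::field) set)) = card S"
  by (simp only: pm.dim_span_eq_card_independent[OF independent_basis_vec]
      card_image[OF inj_on_subset[OF inj_basis_vec subset_UNIV]])

text \<open>Turns membership in a graded piece into a condition on supports, which can be checked
  monomial by monomial.\<close>

lemma span_basis_vec:
  "pm.span (basis_vec ` S) = {v :: 'b \<Rightarrow>\<^sub>0 'k::field. Poly_Mapping.keys v \<subseteq> S}"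
proof (rule pm.span_subspace)
  show "basis_vec ` S \<subseteq> {v :: 'b \<Rightarrow>\<^sub>0 'k. Poly_Mapping.keys v \<subseteq> S}" by (auto simp: basis_vec_def)
  show "{v :: 'b \<Rightarrow>\<^sub>0 'k. Poly_Mapping.keys v \<subseteq> S} \<subseteq> pm.span (basis_vec ` S)"
  proof clarify
    fix v :: "'b \<Rightarrow>\<^sub>0 'k" assume v: "Poly_Mapping.keys v \<subseteq> S"
    have "v = (\<Sum>b\<in>Poly_Mapping.keys v. pm_scale (Poly_Mapping.lookup v b) (basis_vec b))"
      using pm_expand[of "Poly_Mapping.keys v" v] by (simp add: basis_vec_def pm_scale_single)
    moreover have "\<dots> \<in> pm.span (basis_vec ` S)"
      using v by (intro pm.span_sum pm.span_scale pm.span_base) auto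
    ultimately show "v \<in> pm.span (basis_vec ` S)" by simp
  qed
  show "pm.subspace {v :: 'b \<Rightarrow>\<^sub>0 'k. Poly_Mapping.keys v \<subseteq> S}"
    unfolding pm.subspace_def
  proof (intro conjI ballI allI CollectI, goal_cases)
    case (2 v w)
    then show ?case using keys_add[of v w] by blast
  qed (auto simp: in_keys_iff)
qed

section \<open>Words\<close>

lemma word_deg_Nil: "word_deg [] = 1"
  by (simp add: word_deg_def)

lemma word_deg_Cons: "word_deg (a # c) = word_deg c + (if a = x0 then 2 else 1)"
  \<comment> \<open>Counting positions through the length of a filtered list makes the degree
    recursive along the word.\<close>
  unfolding word_deg_def length_filter_conv_card[of "\<lambda>l. l = x0", symmetric] by simp

lemma word_deg_pos: "0 < word_deg c"
  by (simp add: word_deg_def)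

lemma words_0: "{c. word_deg c = 0} = {}"
  by (simp add: word_deg_def)

lemma words_1: "{c. word_deg c = Suc 0} = {[]}"
  by (auto simp: word_deg_def)

lemma words_Suc_Suc:
  "{c. word_deg c = Suc (Suc k)} =
    Cons x0 ` {c. word_deg c = k} \<union> Cons x1 ` {c. word_deg c = Suc k}"
proof (intro equalityI subsetI)
  fix c assume c: "c \<in> {c. word_deg c = Suc (Suc k)}"
  then obtain a d where "c = a # d" by (cases c) (auto simp: word_deg_Nil)
  with c show "c \<in> Cons x0 ` {c. word_deg c = k} \<union> Cons x1 ` {c. word_deg c = Suc k}"
    by (cases a) (auto simp: word_deg_Cons)
qed (auto simp: word_deg_Cons)

lemma finite_words: "finite {c. word_deg c = k}"
  by (induction k rule: fib.induct) (simp_all add: words_0 words_1 words_Suc_Suc)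

lemma card_words: "card {c. word_deg c = k} = fib k"
proof (induction k rule: fib.induct)
  case (3 k)
  then show ?case
    by (subst words_Suc_Suc, subst card_Un_disjoint)
      (auto simp: finite_words card_image)
qed (simp_all add: words_0 words_1)

lemma V_part_eq: "V_part k = pm.span (basis_vec ` {c. word_deg c = k})"
  unfolding V_part_def X_def basis_vec_def by (rule arg_cong[of _ _ pm.span]) auto

lemma dim_V_part: "pm.dim (V_part k :: 'k::field V set) = fib k"
  by (simp only: V_part_eq dim_span_basis_vec card_words)

text \<open>Multiplying by \<open>fps_X\<close> and \<open>fps_X ^ 2\<close> shifts the sequence, so
  this is the Fibonacci recursion; the right-hand side \<open>fps_X\<close> corrects the coefficient
  at 1, where the recursion does not apply.\<close>

lemma fib_fps:
  "(1 - fps_X - fps_X ^ 2) * Abs_fps (\<lambda>k. of_nat (fib k)) = (fps_X :: rat fps)"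
proof -
  let ?F = "Abs_fps (\<lambda>k. of_nat (fib k)) :: rat fps"
  have "?F = fps_X + fps_X ^ 2 * ?F + fps_X * ?F"
  proof (rule fps_ext)
    fix n
    consider "n = 0" | "n = Suc 0" | k where "n = Suc (Suc k)"
      by (metis not0_implies_Suc)
    then show "fps_nth ?F n = fps_nth (fps_X + fps_X ^ 2 * ?F + fps_X * ?F) n"
      by cases (simp_all add: fps_X_power_mult_nth fps_X_nth)
  qed
  then show ?thesis unfolding left_diff_distrib mult_1_left diff_eq_eq .
qed

section \<open>Monomials\<close>

text \<open>The degree of the monomial with exponents \<open>m\<close> when the indeterminate
  \<open>b\<close> has degree \<open>d b\<close>.\<close>

definition weight :: "('b \<Rightarrow> nat) \<Rightarrow> ('b \<Rightarrow>\<^sub>0 nat) \<Rightarrow> nat" where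
  "weight d m = (\<Sum>b\<in>Poly_Mapping.keys m. Poly_Mapping.lookup m b * d b)"

definition monoms :: "('b \<Rightarrow> nat) \<Rightarrow> 'b set \<Rightarrow> nat \<Rightarrow> ('b \<Rightarrow>\<^sub>0 nat) set" where
  "monoms d A k = {m. Poly_Mapping.keys m \<subseteq> A \<and> weight d m = k}"

lemma weight_expand:
  assumes "finite A" "Poly_Mapping.keys m \<subseteq> A"
  shows "weight d m = (\<Sum>b\<in>A. Poly_Mapping.lookup m b * d b)"
  unfolding weight_def using assms
  by (intro sum.mono_neutral_left) (auto simp: in_keys_iff)

lemma weight_0 [simp]: "weight d 0 = 0"
  by (simp add: weight_def)

lemma weight_single [simp]: "weight d (Poly_Mapping.single b n) = n * d b"
  by (simp add: weight_def)

lemma weight_add: "weight d (m + n) = weight d m + weight d n"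
proof -
  let ?A = "Poly_Mapping.keys m \<union> Poly_Mapping.keys n"
  have "Poly_Mapping.keys (m + n) \<subseteq> ?A" by (rule keys_add)
  then show ?thesis
    by (simp add: weight_expand[of ?A] lookup_add distrib_right sum.distrib)
qed

lemma monomial_cases:
  fixes m :: "'b \<Rightarrow>\<^sub>0 nat"
  assumes "b \<in> Poly_Mapping.keys m"
  obtains n where "m = n + Poly_Mapping.single b 1" "Poly_Mapping.keys n \<subseteq> Poly_Mapping.keys m"
proof
  show "m = (m - Poly_Mapping.single b 1) + Poly_Mapping.single b 1"
    using assms
    by (intro poly_mapping_eqI) (auto simp: lookup_add lookup_minus lookup_single when_def in_keys_iff)
  show "Poly_Mapping.keys (m - Poly_Mapping.single b 1) \<subseteq> Poly_Mapping.keys m"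
    by (auto simp: in_keys_iff lookup_minus)
qed

lemma le_weight: "b \<in> Poly_Mapping.keys m \<Longrightarrow> d b \<le> weight d m"
  by (erule monomial_cases) (simp add: weight_add)

lemma keys_add_single_nat:
  "0 < n \<Longrightarrow> Poly_Mapping.keys (m + Poly_Mapping.single b (n::nat)) = insert b (Poly_Mapping.keys m)"
  by (auto simp: in_keys_iff lookup_add lookup_single when_def split: if_splits)

lemma monoms_empty: "monoms d {} k = (if k = 0 then {0} else {})"
  by (auto simp: monoms_def)

text \<open>A monomial either avoids \<open>b\<close> or is divisible by it. After division
  \<open>b\<close> may still occur, so \<open>insert b A\<close> reappears on the right. The guard
  \<open>d b \<le> k\<close> excludes truncated subtraction.\<close>

lemma monoms_insert:
  "monoms d (insert b A) k = monoms d A k \<union>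
    (if d b \<le> k then (\<lambda>m. m + Poly_Mapping.single b 1) ` monoms d (insert b A) (k - d b) else {})"
  (is "?L = ?R")
proof (intro equalityI subsetI)
  fix m assume m: "m \<in> ?L"
  show "m \<in> ?R"
  proof (cases "b \<in> Poly_Mapping.keys m")
    case True
    then obtain n where n: "m = n + Poly_Mapping.single b 1" "Poly_Mapping.keys n \<subseteq> Poly_Mapping.keys m"
      by (rule monomial_cases)
    with m have "n \<in> monoms d (insert b A) (k - d b)" "d b \<le> k"
      by (auto simp: monoms_def weight_add)
    with n(1) show ?thesis by auto
  qed (use m in \<open>auto simp: monoms_def\<close>)
next
  fix m assume "m \<in> ?R"
  then show "m \<in> ?L"
    by (auto simp: monoms_def weight_add keys_add_single_nat split: if_splits)
qed

lemma finite_monoms: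
  assumes "finite A" "\<And>b. b \<in> A \<Longrightarrow> 0 < d b"
  shows "finite (monoms d A k)"
  using assms
proof (induction A arbitrary: k)
  case (insert b A)
  show ?case
  \<comment> \<open>The recursion in \<open>monoms_insert\<close> keeps the set
    \<open>insert b A\<close> but lowers \<open>k\<close>, because \<open>d b\<close> is
    positive.\<close>
  proof (induction k rule: less_induct)
    case (less k)
    have "finite (monoms d (insert b A) (k - d b))" if "d b \<le> k"
      using that insert.prems[of b] by (intro less.IH diff_less) auto
    then show ?case
      using insert by (subst monoms_insert) simp
  qed
qed (simp add: monoms_empty)

lemma card_monoms_insert:
  assumes "finite A" "\<And>a. a \<in> insert b A \<Longrightarrow> 0 < d a" "b \<notin> A"
  shows "card (monoms d (insert b A) k) =
    card (monoms d A k) + (if d b \<le> k then card (monoms d (insert b A) (k - d b)) else 0)"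
proof -
  let ?f = "\<lambda>m. m + Poly_Mapping.single b (1::nat)"
  \<comment> \<open>Monomials in the image contain \<open>b\<close>, those over \<open>A\<close> do
    not.\<close>
  have disj: "monoms d A k \<inter> ?f ` monoms d (insert b A) (k - d b) = {}"
    using assms(3) by (auto simp: monoms_def keys_add_single_nat)
  have "card (?f ` monoms d (insert b A) (k - d b)) = card (monoms d (insert b A) (k - d b))"
    by (rule card_image) (auto intro: inj_onI)
  moreover have "finite (monoms d A k)" "finite (monoms d (insert b A) (k - d b))"
    using assms by (auto intro!: finite_monoms)
  ultimately show ?thesis
    using disj by (subst monoms_insert) (simp add: card_Un_disjoint)
qed

section \<open>Generating functions of monomials\<close>

definition hilbert_fps :: "('b \<Rightarrow> nat) \<Rightarrow> 'b set \<Rightarrow> rat fps" where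
  "hilbert_fps d A = Abs_fps (\<lambda>k. of_nat (card (monoms d A k)))"

lemma hilbert_fps_nth: "fps_nth (hilbert_fps d A) k = of_nat (card (monoms d A k))"
  by (simp add: hilbert_fps_def)

lemma fps_eq_divide_unit:
  fixes f g q :: "'a::field fps"
  assumes "fps_nth g 0 \<noteq> 0" "g * q = f"
  shows "q = f / g"
proof -
  have "g \<noteq> 0" using assms(1) by auto
  then show ?thesis using assms(2) by auto
qed

lemma hilbert_fps_eq_prod:
  assumes "finite A" "\<And>b. b \<in> A \<Longrightarrow> 0 < d b"
  shows "hilbert_fps d A = (\<Prod>b\<in>A. 1 / (1 - fps_X ^ d b))"
  using assms
proof (induction A)
  case empty
  then show ?case by (auto intro!: fps_ext simp: hilbert_fps_nth monoms_empty)
next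
  case (insert b A)
  \<comment> \<open>The constant coefficient is 1 because \<open>d b\<close> is positive, so
    division by this series is legitimate.\<close>
  have nz: "fps_nth (1 - fps_X ^ d b :: rat fps) 0 \<noteq> 0"
    using insert.prems by simp
  have "(1 - fps_X ^ d b) * hilbert_fps d (insert b A) = hilbert_fps d A"
  proof (rule fps_ext)
    fix k
    show "fps_nth ((1 - fps_X ^ d b) * hilbert_fps d (insert b A)) k = fps_nth (hilbert_fps d A) k"
      using card_monoms_insert[OF insert(1) insert.prems insert(2), where k = k]
      by (simp add: left_diff_distrib fps_X_power_mult_nth hilbert_fps_nth)
  qed
  then have "hilbert_fps d (insert b A) = hilbert_fps d A / (1 - fps_X ^ d b)"
    by (rule fps_eq_divide_unit[OF nz])
  also have "\<dots> = 1 / (1 - fps_X ^ d b) * hilbert_fps d A"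
    using nz by (simp add: fps_divide_unit mult.commute)
  finally show ?case using insert by simp
qed

lemma one_div_power_fps:
  fixes f :: "'a::field fps"
  assumes "fps_nth f 0 \<noteq> 0"
  shows "(1 / f) ^ n = 1 / f ^ n"
  using assms by (simp add: fps_divide_unit fps_inverse_power)

text \<open>Grouping indeterminates by degree identifies each partial product with the series of a
  finite set of indeterminates; these series converge coefficientwise.\<close>

lemma has_prod_hilbert_fps:
  assumes fin: "\<And>k. finite {b. d b = k}" and pos: "\<And>b. 0 < d b"
  shows "(\<lambda>k. 1 / (1 - fps_X ^ Suc k) ^ card {b. d b = Suc k}) has_prod hilbert_fps d UNIV"
proof -
  let ?A = "\<lambda>n. {b. d b \<le> n}"
  have finA: "finite (?A n)" for n
    using fin by (intro finite_subset[of "{b. d b \<le> n}" "\<Union>k\<le>n. {b. d b = k}"]) auto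
  have partial: "(\<Prod>k\<le>n. 1 / (1 - fps_X ^ Suc k) ^ card {b. d b = Suc k}) = hilbert_fps d (?A (Suc n))"
    for n
  proof -
    have "hilbert_fps d (?A (Suc n)) = (\<Prod>b\<in>?A (Suc n). 1 / (1 - fps_X ^ d b))"
      using finA pos by (rule hilbert_fps_eq_prod)
    \<comment> \<open>The factor with index \<open>k\<close> collects the degree
      \<open>Suc k\<close>, hence the shift to \<open>d b - 1\<close>; positivity of
      \<open>d\<close> makes it lossless.\<close>
    also have "\<dots> = (\<Prod>k\<in>{..n}. \<Prod>b\<in>{b \<in> ?A (Suc n). d b - 1 = k}. 1 / (1 - fps_X ^ d b))"
      using pos by (intro prod.group[symmetric] finA) auto
    also have "\<dots> = (\<Prod>k\<le>n. 1 / (1 - fps_X ^ Suc k) ^ card {b. d b = Suc k})"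
    proof (rule prod.cong)
      fix k assume "k \<in> {..n}"
      have "{b \<in> ?A (Suc n). d b - 1 = k} = {b. d b = Suc k}"
        using pos \<open>k \<in> {..n}\<close> by (fastforce simp: Suc_le_eq)
      then show "(\<Prod>b\<in>{b \<in> ?A (Suc n). d b - 1 = k}. 1 / (1 - fps_X ^ d b)) =
          (1 / (1 - fps_X ^ Suc k) ^ card {b. d b = Suc k} :: rat fps)"
        by (simp add: one_div_power_fps del: power_Suc)
    qed simp
    finally show ?thesis by simp
  qed
  have "(\<lambda>n. hilbert_fps d (?A (Suc n))) \<longlonglongrightarrow> hilbert_fps d UNIV"
  proof (rule tendsto_fpsI)
    fix k
    have "monoms d (?A (Suc n)) k = monoms d UNIV k" if "k \<le> n" for n
      using that le_weight[of _ _ d] by (force simp: monoms_def)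
    then show "\<forall>\<^sub>F n in sequentially. fps_nth (hilbert_fps d (?A (Suc n))) k = fps_nth (hilbert_fps d UNIV) k"
      by (intro eventually_sequentiallyI[of k]) (simp add: hilbert_fps_nth)
  qed
  \<comment> \<open>\<open>has_prod\<close> without zero factors requires a nonzero limit. Here the
    constant coefficient is 1, since only the trivial monomial has weight 0.\<close>
  moreover have "hilbert_fps d UNIV \<noteq> 0"
  proof -
    have "m = 0" if "weight d m = 0" for m
      using that pos le_weight[of _ m d] by (metis keys_eq_empty ex_in_conv le_zero_eq less_numeral_extra(3))
    then have "monoms d UNIV 0 = {0}" by (auto simp: monoms_def)
    then have "fps_nth (hilbert_fps d UNIV) 0 = 1" by (simp add: hilbert_fps_nth)
    then show ?thesis by auto
  qed
  ultimately show ?thesis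
    by (simp add: has_prod_def raw_has_prod_def partial del: power_Suc)
qed

section \<open>The grading of the symmetric algebra\<close>

lemma keys_incl:
  assumes "v \<in> V_part k" "m \<in> Poly_Mapping.keys (incl v)"
  shows "weight word_deg m = k"
proof -
  have "Poly_Mapping.keys (incl v) \<subseteq> (\<Union>c\<in>Poly_Mapping.keys v. Poly_Mapping.keys
      (Poly_Mapping.single (Poly_Mapping.single c (1::nat)) (Poly_Mapping.lookup v c)))"
    unfolding incl_def pm_scale_single mult_1_right by (rule keys_sum)
  with assms(2) obtain c where c: "c \<in> Poly_Mapping.keys v"
    "m \<in> Poly_Mapping.keys (Poly_Mapping.single (Poly_Mapping.single c (1::nat)) (Poly_Mapping.lookup v c))"
    by blast
  have "m = Poly_Mapping.single c 1"
    using c(2) by (simp split: if_splits)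
  then have "weight word_deg m = word_deg c"
    by (simp only: weight_single mult_1)
  also have "\<dots> = k"
    using assms(1) c(1) unfolding V_part_eq span_basis_vec by blast
  finally show ?thesis .
qed

text \<open>Weights add under multiplication of monomials; this gives the inclusion of
  \<open>H_part\<close> in the span of the monomials of the right weight.\<close>

lemma keys_prod_incl:
  fixes n :: nat
  assumes "\<forall>i<n. v i \<in> V_part (d i)" "m \<in> Poly_Mapping.keys (\<Prod>i<n. incl (v i))"
  shows "weight word_deg m = (\<Sum>i<n. d i)"
  using assms
proof (induction n arbitrary: m)
  case 0
  then show ?case by simp
next
  case (Suc n)
  have "m \<in> Poly_Mapping.keys ((\<Prod>i<n. incl (v i)) * incl (v n))"
    using Suc.prems(2) by (simp only: prod.lessThan_Suc)
  with keys_mult[of "\<Prod>i<n. incl (v i)" "incl (v n)"]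
  obtain a b where m: "m = a + b" "a \<in> Poly_Mapping.keys (\<Prod>i<n. incl (v i))"
    "b \<in> Poly_Mapping.keys (incl (v n))"
    by blast
  have "weight word_deg a = (\<Sum>i<n. d i)" using Suc.prems(1) m(2) by (intro Suc.IH) auto
  moreover have "weight word_deg b = d n" using Suc.prems(1) m(3) by (intro keys_incl) auto
  ultimately show ?case by (simp add: m(1) weight_add)
qed

text \<open>Conversely, indeterminates are peeled off a monomial one at a time; each has positive
  degree, so the weight drops.\<close>

lemma basis_vec_eq_prod_incl:
  fixes m :: "word \<Rightarrow>\<^sub>0 nat"
  shows "\<exists>n c. (basis_vec m :: 'k::field H) = (\<Prod>i<n. incl (X (c i))) \<and>
    weight word_deg m = (\<Sum>i<(n::nat). word_deg (c i))"
proof (induction "weight word_deg m" arbitrary: m rule: less_induct)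
  case less
  show ?case
  proof (cases "m = 0")
    case True
    then show ?thesis by (intro exI[of _ 0]) (simp add: basis_vec_def)
  next
    case False
    then obtain b where "b \<in> Poly_Mapping.keys m" by (metis keys_eq_empty ex_in_conv)
    then obtain m' where m': "m = m' + Poly_Mapping.single b 1" by (rule monomial_cases)
    have "weight word_deg m' < weight word_deg m" by (simp add: m' weight_add word_deg_pos)
    from less[OF this] obtain n :: nat and c where IH: "(basis_vec m' :: 'k H) = (\<Prod>i<n. incl (X (c i)))"
      "weight word_deg m' = (\<Sum>i<n. word_deg (c i))" by blast
    have "(basis_vec m :: 'k H) = basis_vec m' * incl (X b)"
      by (simp add: m' basis_vec_def incl_X mult_single)
    then show ?thesis using IH
      \<comment> \<open>The new factor is placed at index \<open>n\<close>, leaving the entries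
        below \<open>n\<close> unchanged.\<close>
      by (intro exI[of _ "Suc n"] exI[of _ "c(n := b)"]) (simp add: m' weight_add)
  qed
qed

lemma H_part_eq: "(H_part k :: 'k::field H set) = pm.span (basis_vec ` monoms word_deg UNIV k)"
  unfolding H_part_def
proof (intro equalityI pm.span_minimal pm.subspace_span subsetI, goal_cases)
  case (1 p)
  then obtain m :: nat and v d where "p = (\<Prod>i<m. incl (v i))" "\<forall>i<m. v i \<in> V_part (d i)"
    "(\<Sum>i<m. d i) = k" by blast
  then show ?case using keys_prod_incl[of m v d] by (auto simp: span_basis_vec monoms_def)
next
  case (2 p)
  then obtain m where m: "p = basis_vec m" "weight word_deg m = k" by (auto simp: monoms_def)
  from basis_vec_eq_prod_incl[of m] obtain n :: nat and c where
    p: "p = (\<Prod>i<n. incl (X (c i)))" and k: "(\<Sum>i<n. word_deg (c i)) = k"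
    using m by metis
  have "X c \<in> (V_part (word_deg c) :: 'k V set)" for c
    unfolding V_part_def by (rule pm.span_base) blast
  then have V: "\<forall>i<n. 1 \<le> word_deg (c i) \<and> X (c i) \<in> (V_part (word_deg (c i)) :: 'k V set)"
    using word_deg_pos by (simp add: Suc_le_eq)
  show ?case
    by (rule pm.span_base, rule CollectI, rule exI[of _ n], rule exI[of _ "\<lambda>i. X (c i)"],
        rule exI[of _ "\<lambda>i. word_deg (c i)"], intro conjI, rule p, rule V, rule k)
qed

lemma dim_H_part: "pm.dim (H_part k :: 'k::field H set) = card (monoms word_deg UNIV k)"
  by (simp only: H_part_eq dim_span_basis_vec)

theorem proposition8:
  fixes p h :: "nat \<Rightarrow> nat" and F_V F_H :: "rat fps"
  defines "p \<equiv> \<lambda>k. pm.dim (V_part k :: 'k::field_char_0 V set)"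
    and "h \<equiv> \<lambda>k. pm.dim (H_part k :: 'k H set)"
    and "F_V \<equiv> Abs_fps (\<lambda>k. if k = 0 then 0 else of_nat (p k))"
    and "F_H \<equiv> Abs_fps (\<lambda>k. of_nat (h k))"
  shows "F_V = fps_X / (1 - fps_X - fps_X ^ 2)
    \<and> (\<forall>k\<ge>1. real (p k) = 1 / sqrt 5 * (((1 + sqrt 5) / 2) ^ k - ((1 - sqrt 5) / 2) ^ k))
    \<and> (\<forall>k\<ge>1. p k = fib k)
    \<and> (\<lambda>k. 1 / (1 - fps_X ^ Suc k) ^ p (Suc k)) has_prod F_H"
proof -
  have p: "p = fib" by (simp add: p_def dim_V_part)
  have "F_V = Abs_fps (\<lambda>k. of_nat (fib k))"
    \<comment> \<open>The separate value at \<open>k = 0\<close> agrees with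
      \<open>fib 0 = 0\<close>.\<close>
    by (auto simp: F_V_def p intro!: fps_ext)
  then have "F_V = fps_X / (1 - fps_X - fps_X ^ 2)"
    using fib_fps by (intro fps_eq_divide_unit) auto
  moreover have "F_H = hilbert_fps word_deg UNIV"
    by (simp add: F_H_def h_def dim_H_part hilbert_fps_def)
  then have "(\<lambda>k. 1 / (1 - fps_X ^ Suc k) ^ p (Suc k)) has_prod F_H"
    using has_prod_hilbert_fps[of word_deg, OF finite_words word_deg_pos] by (simp only: p card_words)
  ultimately show ?thesis
    by (simp add: p fib_closed_form)
qed

end
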